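(* Let $I$ be an ideal of a right coherent monoid $S$ such that $I$ has an identity (i.e. there is $e\in I$ with $ea=ae=a$ for all $a\in I$). Then the monoid $I$ is right coherent.
   Context: An ideal of a monoid $S$ is a two-sided ideal: a subset $I$ with $SI\subseteq I$ and $IS\subseteq I$. The identity of $I$ need not be the identity of $S$. Let $S$ be a monoid. A right $S$-act is a set $A$ with a map $A\times S\to A$, $(a,s)\mapsto as$, with $a1=a$ and $a(st)=(as)t$. The free right $S$-act on a set $X$ is $F_S(X)=X\times S$ with $(x,s)t=(x,st)$. A congruence on a right $S$-act is an equivalence relation preserved by the action; it is finitely generated if it is the smallest congruence containing some finite set of pairs. An act $A$ is finitely generated if $A=a_1S\cup\dots\cup a_nS$ for some $a_i\in A$, and finitely presented if it is isomorphic to $F_S(X)/\rho$ with $X$ finite and $\rho$ a finitely generated congruence. The empty set is allowed as a subact (and is finitely generated). The monoid $S$ is right coherent if every finitely generated subact of every finitely presented right $S$-act is finitely presented. *)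

theory Defs
  imports "HOL-Algebra.Group"
begin

locale right_act = monoid S for S (structure) +
  fixes A :: "'b set" and act :: "'b \<Rightarrow> 'a \<Rightarrow> 'b"
  assumes act_closed: "a \<in> A \<Longrightarrow> s \<in> carrier S \<Longrightarrow> act a s \<in> A"
    and act_one: "a \<in> A \<Longrightarrow> act a \<one> = a"
    and act_mult: "a \<in> A \<Longrightarrow> s \<in> carrier S \<Longrightarrow> t \<in> carrier S \<Longrightarrow>
      act a (s \<otimes> t) = act (act a s) t"

text \<open>The empty set is a subact, and it is finitely generated (by no elements).\<close>

definition subact ::
    "('a, 'm) monoid_scheme \<Rightarrow> 'b set \<Rightarrow> 'b set \<Rightarrow> ('b \<Rightarrow> 'a \<Rightarrow> 'b) \<Rightarrow> bool" where
  "subact S B A act \<longleftrightarrow> B \<subseteq> A \<and> (\<forall>b\<in>B. \<forall>s\<in>carrier S. act b s \<in> B)"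

definition fg_act :: "('a, 'm) monoid_scheme \<Rightarrow> 'b set \<Rightarrow> ('b \<Rightarrow> 'a \<Rightarrow> 'b) \<Rightarrow> bool" where
  "fg_act S A act \<longleftrightarrow> (\<exists>G. finite G \<and> G \<subseteq> A \<and> A = (\<Union>g\<in>G. act g ` carrier S))"

definition act_congruence ::
    "('a, 'm) monoid_scheme \<Rightarrow> 'b set \<Rightarrow> ('b \<Rightarrow> 'a \<Rightarrow> 'b) \<Rightarrow> ('b \<times> 'b) set \<Rightarrow> bool" where
  "act_congruence S A act \<rho> \<longleftrightarrow>
     equiv A \<rho> \<and> (\<forall>(a, b)\<in>\<rho>. \<forall>s\<in>carrier S. (act a s, act b s) \<in> \<rho>)"

definition fg_congruence ::
    "('a, 'm) monoid_scheme \<Rightarrow> 'b set \<Rightarrow> ('b \<Rightarrow> 'a \<Rightarrow> 'b) \<Rightarrow> ('b \<times> 'b) set \<Rightarrow> bool" where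
  "fg_congruence S A act \<rho> \<longleftrightarrow> act_congruence S A act \<rho> \<and>
     (\<exists>H. finite H \<and> H \<subseteq> \<rho> \<and> (\<forall>\<sigma>. act_congruence S A act \<sigma> \<and> H \<subseteq> \<sigma> \<longrightarrow> \<rho> \<subseteq> \<sigma>))"

text \<open>The action on classes: the class of \<open>a\<close> is sent by \<open>s\<close> to the class of \<open>a s\<close>,
  independently of the representative when \<open>\<rho>\<close> is a congruence.\<close>

definition quot_action :: "('b \<Rightarrow> 'a \<Rightarrow> 'b) \<Rightarrow> ('b \<times> 'b) set \<Rightarrow> 'b set \<Rightarrow> 'a \<Rightarrow> 'b set" where
  "quot_action act \<rho> C s = \<rho> `` ((\<lambda>a. act a s) ` C)"

definition free_act :: "('a, 'm) monoid_scheme \<Rightarrow> 'x set \<Rightarrow> ('x \<times> 'a) set" where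
  "free_act S X = X \<times> carrier S"

definition free_action :: "('a, 'm) monoid_scheme \<Rightarrow> 'x \<times> 'a \<Rightarrow> 'a \<Rightarrow> 'x \<times> 'a" where
  "free_action S p t = (fst p, snd p \<otimes>\<^bsub>S\<^esub> t)"

definition act_iso ::
    "('a, 'm) monoid_scheme \<Rightarrow> 'b set \<Rightarrow> ('b \<Rightarrow> 'a \<Rightarrow> 'b) \<Rightarrow>
      'c set \<Rightarrow> ('c \<Rightarrow> 'a \<Rightarrow> 'c) \<Rightarrow> ('b \<Rightarrow> 'c) \<Rightarrow> bool" where
  "act_iso S A act B act' f \<longleftrightarrow>
     bij_betw f A B \<and> (\<forall>a\<in>A. \<forall>s\<in>carrier S. f (act a s) = act' (f a) s)"

text \<open>The free act on a finite set depends, up to isomorphism, only on the number of generators,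
  so finite sets of natural numbers suffice as generating sets (see \<open>fp_actI\<close>).\<close>

definition fp_act :: "('a, 'm) monoid_scheme \<Rightarrow> 'b set \<Rightarrow> ('b \<Rightarrow> 'a \<Rightarrow> 'b) \<Rightarrow> bool" where
  "fp_act S A act \<longleftrightarrow> right_act S A act \<and>
     (\<exists>(X :: nat set) \<rho> f. finite X \<and> fg_congruence S (free_act S X) (free_action S) \<rho> \<and>
        act_iso S (free_act S X // \<rho>) (quot_action (free_action S) \<rho>) A act f)"

text \<open>A definition cannot quantify over all types, so the acts range over the type containing all
  the quotients of the free acts used in \<open>fp_act\<close>.  Every finitely presented act, on any type,
  is isomorphic to one of these; \<open>right_coherent_any_type\<close> shows that nothing is lost.\<close>

definition right_coherent :: "('a, 'm) monoid_scheme \<Rightarrow> bool" where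
  "right_coherent S \<longleftrightarrow> monoid S \<and>
     (\<forall>(A :: (nat \<times> 'a) set set) act B.
        fp_act S A act \<and> subact S B A act \<and> fg_act S B act \<longrightarrow> fp_act S B act)"

text \<open>Two-sided ideal of a monoid; \<open>ideal\<close> in \<open>HOL-Algebra\<close> is the ring-theoretic notion.\<close>

definition monoid_ideal :: "'a set \<Rightarrow> ('a, 'm) monoid_scheme \<Rightarrow> bool" where
  "monoid_ideal I S \<longleftrightarrow> I \<subseteq> carrier S \<and>
     (\<forall>s\<in>carrier S. \<forall>a\<in>I. s \<otimes>\<^bsub>S\<^esub> a \<in> I \<and> a \<otimes>\<^bsub>S\<^esub> s \<in> I)"

lemma right_act_iso:
  assumes "right_act S A act" "act_iso S A act B act' f"
    and cl: "\<And>b s. b \<in> B \<Longrightarrow> s \<in> carrier S \<Longrightarrow> act' b s \<in> B"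
  shows "right_act S B act'"
proof -
  interpret right_act S A act by fact
  have im: "B = f ` A" and h: "\<And>a s. a \<in> A \<Longrightarrow> s \<in> carrier S \<Longrightarrow> act' (f a) s = f (act a s)"
    using assms(2) by (auto simp: act_iso_def bij_betw_def)
  show ?thesis
    by unfold_locales (auto simp: im h act_one act_mult act_closed)
qed

lemma act_iso_trans:
  assumes "act_iso S A act B act' f" "act_iso S B act' C act'' g"
  shows "act_iso S A act C act'' (g \<circ> f)"
  using assms bij_betw_trans[of f A B g C] by (auto simp: act_iso_def bij_betw_def)

lemma act_iso_inv:
  assumes "right_act S A act" "act_iso S A act B act' f"
  shows "act_iso S B act' A act (inv_into A f)"
proof -
  interpret right_act S A act by fact
  have b: "bij_betw f A B"
    and h: "\<And>a s. a \<in> A \<Longrightarrow> s \<in> carrier S \<Longrightarrow> f (act a s) = act' (f a) s"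
    using assms(2) by (auto simp: act_iso_def)
  have "inv_into A f (act' y s) = act (inv_into A f y) s" if y: "y \<in> B" "s \<in> carrier S" for y s
  proof -
    obtain a where a: "a \<in> A" "y = f a" using b y by (auto simp: bij_betw_def)
    have "inv_into A f (act' y s) = inv_into A f (f (act a s))" using a y h by simp
    also have "\<dots> = act a s" using b a y act_closed by (simp add: bij_betw_inv_into_left)
    also have "\<dots> = act (inv_into A f y) s" using b a by (simp add: bij_betw_inv_into_left)
    finally show ?thesis .
  qed
  then show ?thesis using b by (auto simp: act_iso_def bij_betw_inv_into)
qed

lemma act_iso_subact:
  assumes "act_iso S A act B act' f" "subact S A' A act"
  shows "act_iso S A' act (f ` A') act' f"
  using assms unfolding act_iso_def subact_def bij_betw_def by (auto intro: inj_on_subset)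

lemma subact_right_act:
  assumes "right_act S A act" "subact S B A act"
  shows "right_act S B act"
proof -
  interpret right_act S A act by fact
  show ?thesis using assms(2)
    by unfold_locales (auto simp: subact_def act_one act_mult subset_iff)
qed

lemma fp_act_iso:
  assumes "fp_act S A act" "act_iso S A act B act' f" "right_act S B act'"
  shows "fp_act S B act'"
  using assms unfolding fp_act_def by (blast intro: act_iso_trans)

lemma right_act_free:
  assumes "monoid S"
  shows "right_act S (free_act S X) (free_action S)"
proof -
  interpret monoid S by fact
  show ?thesis by unfold_locales (auto simp: free_act_def free_action_def m_assoc)
qed

lemma quot_action_class:
  assumes "right_act S A act" "act_congruence S A act \<rho>" "a \<in> A" "s \<in> carrier S"
  shows "quot_action act \<rho> (\<rho> `` {a}) s = \<rho> `` {act a s}"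
proof -
  have eq: "equiv A \<rho>"
    and c: "\<And>x y. (x, y) \<in> \<rho> \<Longrightarrow> (act x s, act y s) \<in> \<rho>"
    using assms by (auto simp: act_congruence_def)
  have aa: "(a, a) \<in> \<rho>" using eq assms(3) by (meson equiv_class_self Image_singleton_iff)
  have tr: "trans \<rho>" using eq by (simp add: equiv_def)
  show ?thesis unfolding quot_action_def using aa c tr by (blast dest: transD)
qed

lemma right_act_quot:
  assumes "right_act S A act" "act_congruence S A act \<rho>"
  shows "right_act S (A // \<rho>) (quot_action act \<rho>)"
proof -
  interpret right_act S A act by fact
  note q = quot_action_class[OF assms]
  show ?thesis
    by unfold_locales
      (auto elim!: quotientE simp: q act_closed act_one act_mult intro: quotientI[OF act_closed])
qed

lemma act_congruence_transfer:
  assumes "right_act S B act'" "act_iso S A act B act' f" "act_congruence S A act \<rho>"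
  shows "act_congruence S B act' (map_prod f f ` \<rho>)"
proof -
  have b: "inj_on f A" "f ` A = B"
    and h: "\<And>a s. a \<in> A \<Longrightarrow> s \<in> carrier S \<Longrightarrow> f (act a s) = act' (f a) s"
    using assms(2) by (auto simp: act_iso_def bij_betw_def)
  have sub: "\<rho> \<subseteq> A \<times> A" and r: "\<And>a. a \<in> A \<Longrightarrow> (a, a) \<in> \<rho>" and s: "sym \<rho>" and t: "trans \<rho>"
    and c: "\<And>x y s. (x, y) \<in> \<rho> \<Longrightarrow> s \<in> carrier S \<Longrightarrow> (act x s, act y s) \<in> \<rho>"
    using assms(3) by (auto simp: act_congruence_def equiv_def refl_on_def)
  have "equiv B (map_prod f f ` \<rho>)"
  proof (intro equivI)
    show "map_prod f f ` \<rho> \<subseteq> B \<times> B" using sub b by auto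
    show "refl_on B (map_prod f f ` \<rho>)" using r b by (force simp: refl_on_def)
    show "sym (map_prod f f ` \<rho>)" using s by (force simp: sym_def)
    show "trans (map_prod f f ` \<rho>)"
    proof (rule transI)
      fix x y z assume "(x, y) \<in> map_prod f f ` \<rho>" "(y, z) \<in> map_prod f f ` \<rho>"
      then obtain p q q' w where *: "(p, q) \<in> \<rho>" "(q', w) \<in> \<rho>" "x = f p" "f q = f q'" "z = f w"
        by auto
      then have "q = q'" using sub b(1) by (auto dest: inj_onD)
      with * t have "(p, w) \<in> \<rho>" by (blast dest: transD)
      with * show "(x, z) \<in> map_prod f f ` \<rho>" by force
    qed
  qed
  moreover have "(act' x s, act' y s) \<in> map_prod f f ` \<rho>"
    if xy: "(x, y) \<in> map_prod f f ` \<rho>" and sS: "s \<in> carrier S" for x y s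
  proof -
    obtain p q where *: "(p, q) \<in> \<rho>" "x = f p" "y = f q" using xy by auto
    then have "p \<in> A" "q \<in> A" using sub by auto
    then have "(act' x s, act' y s) = map_prod f f (act p s, act q s)" using * h sS by simp
    then show ?thesis using c[OF *(1) sS] by (rule image_eqI)
  qed
  ultimately show ?thesis unfolding act_congruence_def by blast
qed

lemma fp_actI:
  fixes S :: "('a, 'm) monoid_scheme" and X :: "'x set"
  assumes A: "right_act S A act" and X: "finite X"
    and fg: "fg_congruence S (free_act S X) (free_action S) \<rho>"
    and iso: "act_iso S (free_act S X // \<rho>) (quot_action (free_action S) \<rho>) A act f"
  shows "fp_act S A act"
proof -
  interpret A: right_act S A act by fact
  have mon: "monoid S" by unfold_locales
  note frX = right_act_free[OF mon, of X]
  obtain g :: "'x \<Rightarrow> nat" where g: "inj_on g X"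
    using finite_imp_inj_to_nat_seg[OF X] by auto
  define Y where "Y = g ` X"
  define k where "k = map_prod g (id :: 'a \<Rightarrow> 'a)"
  let ?FX = "free_act S X" and ?FY = "free_act S Y" and ?m = "free_action S"
  note frY = right_act_free[OF mon, of Y]
  have k: "act_iso S ?FX ?m ?FY ?m k"
    using g unfolding act_iso_def bij_betw_def k_def Y_def free_act_def free_action_def
    by (auto simp: inj_on_def map_prod_surj_on)
  define l where "l = inv_into ?FX k"
  have l: "act_iso S ?FY ?m ?FX ?m l" unfolding l_def by (rule act_iso_inv[OF frX k])
  have kl: "\<And>y. y \<in> ?FY \<Longrightarrow> k (l y) = y" and lk: "\<And>x. x \<in> ?FX \<Longrightarrow> l (k x) = x"
    using k by (auto simp: l_def act_iso_def bij_betw_inv_into_left bij_betw_inv_into_right)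
  have kF: "\<And>x. x \<in> ?FX \<Longrightarrow> k x \<in> ?FY" and lF: "\<And>y. y \<in> ?FY \<Longrightarrow> l y \<in> ?FX"
    using k l by (auto simp: act_iso_def bij_betw_def)
  define \<tau> where "\<tau> = map_prod k k ` \<rho>"
  have cg: "act_congruence S ?FX ?m \<rho>" using fg by (simp add: fg_congruence_def)
  have cg': "act_congruence S ?FY ?m \<tau>"
    unfolding \<tau>_def by (rule act_congruence_transfer[OF frY k cg])
  have sub: "\<rho> \<subseteq> ?FX \<times> ?FX" using cg by (auto simp: act_congruence_def equiv_def)
  have "fg_congruence S ?FY ?m \<tau>"
  proof -
    obtain H where H: "finite H" "H \<subseteq> \<rho>"
      "\<And>\<sigma>. act_congruence S ?FX ?m \<sigma> \<Longrightarrow> H \<subseteq> \<sigma> \<Longrightarrow> \<rho> \<subseteq> \<sigma>"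
      using fg by (auto simp: fg_congruence_def)
    have "\<tau> \<subseteq> \<sigma>" if s: "act_congruence S ?FY ?m \<sigma>" "map_prod k k ` H \<subseteq> \<sigma>" for \<sigma>
    proof -
      have sF: "\<sigma> \<subseteq> ?FY \<times> ?FY" using s(1) by (auto simp: act_congruence_def equiv_def)
      have "act_congruence S ?FX ?m (map_prod l l ` \<sigma>)"
        by (rule act_congruence_transfer[OF frX l s(1)])
      moreover have "H \<subseteq> map_prod l l ` \<sigma>"
      proof
        fix p assume p: "p \<in> H"
        then have "map_prod l l (map_prod k k p) = p" using sub H(2) lk by (cases p) auto
        with p s(2) show "p \<in> map_prod l l ` \<sigma>" by (metis image_eqI image_subset_iff)
      qed
      ultimately have rs: "\<rho> \<subseteq> map_prod l l ` \<sigma>" by (rule H(3))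
      show ?thesis
      proof
        fix q assume "q \<in> \<tau>"
        then obtain p where "p \<in> \<sigma>" "q = map_prod k k (map_prod l l p)"
          using rs by (auto simp: \<tau>_def)
        with sF kl show "q \<in> \<sigma>" by (cases p) auto
      qed
    qed
    with H(1,2) cg' show ?thesis
      unfolding fg_congruence_def \<tau>_def by (meson finite_imageI image_mono)
  qed
  moreover have "act_iso S (?FY // \<tau>) (quot_action ?m \<tau>) (?FX // \<rho>) (quot_action ?m \<rho>) (image l)"
  proof -
    have cls: "l ` (\<tau> `` {y}) = \<rho> `` {l y}" if y: "y \<in> ?FY" for y
    proof
      show "l ` (\<tau> `` {y}) \<subseteq> \<rho> `` {l y}" using sub lk by (auto simp: \<tau>_def)
      show "\<rho> `` {l y} \<subseteq> l ` (\<tau> `` {y})"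
      proof
        fix x assume "x \<in> \<rho> `` {l y}"
        then have r: "(l y, x) \<in> \<rho>" by simp
        then have "(y, k x) \<in> \<tau>" using kl[OF y] unfolding \<tau>_def by force
        moreover have "x \<in> ?FX" using r sub by auto
        then have "x = l (k x)" using lk by simp
        ultimately show "x \<in> l ` (\<tau> `` {y})" by blast
      qed
    qed
    have sF: "\<tau> \<subseteq> ?FY \<times> ?FY" using cg' by (auto simp: act_congruence_def equiv_def)
    have "inj_on (image l) (?FY // \<tau>)"
    proof (rule inj_on_subset[OF inj_on_image_Pow])
      show "inj_on l ?FY" using l by (simp add: act_iso_def bij_betw_def)
      show "?FY // \<tau> \<subseteq> Pow ?FY" using sF by (auto elim!: quotientE)
    qed
    moreover have "image l ` (?FY // \<tau>) = ?FX // \<rho>"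
    proof
      show "image l ` (?FY // \<tau>) \<subseteq> ?FX // \<rho>"
      proof
        fix D assume "D \<in> image l ` (?FY // \<tau>)"
        then obtain y where y: "y \<in> ?FY" "D = l ` (\<tau> `` {y})" by (auto elim!: quotientE)
        show "D \<in> ?FX // \<rho>" using cls[OF y(1)] y(2) quotientI[OF lF[OF y(1)]] by simp
      qed
      show "?FX // \<rho> \<subseteq> image l ` (?FY // \<tau>)"
      proof
        fix C assume "C \<in> ?FX // \<rho>"
        then obtain x where x: "x \<in> ?FX" "C = \<rho> `` {x}" by (auto elim: quotientE)
        then have "C = l ` (\<tau> `` {k x})" using cls[OF kF[OF x(1)]] lk by simp
        with kF[OF x(1)] show "C \<in> image l ` (?FY // \<tau>)" by (auto intro: quotientI)
      qed
    qed
    moreover have "l ` quot_action ?m \<tau> C s = quot_action ?m \<rho> (l ` C) s"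
      if C: "C \<in> ?FY // \<tau>" and s: "s \<in> carrier S" for C s
    proof -
      obtain y where y: "y \<in> ?FY" "C = \<tau> `` {y}" using C by (auto elim: quotientE)
      have my: "?m y s \<in> ?FY" using right_act.act_closed[OF frY y(1) s] .
      have "l (?m y s) = ?m (l y) s" using l y(1) s by (simp add: act_iso_def)
      then show ?thesis
        using quot_action_class[OF frY cg' y(1) s] quot_action_class[OF frX cg lF[OF y(1)] s]
          cls[OF y(1)] cls[OF my] y(2) by simp
    qed
    ultimately show ?thesis by (auto simp: act_iso_def bij_betw_def)
  qed
  then have "act_iso S (?FY // \<tau>) (quot_action ?m \<tau>) A act (f \<circ> image l)"
    using iso by (rule act_iso_trans)
  moreover have "finite Y" using X by (simp add: Y_def)
  ultimately show ?thesis unfolding fp_act_def using A by blast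
qed

lemma right_coherent_any_type:
  fixes A :: "'b set"
  assumes S: "right_coherent S" and A: "fp_act S A act" and B: "subact S B A act" "fg_act S B act"
  shows "fp_act S B act"
proof -
  obtain X :: "nat set" and \<rho> f where X: "finite X"
    and fg: "fg_congruence S (free_act S X) (free_action S) \<rho>"
    and iso: "act_iso S (free_act S X // \<rho>) (quot_action (free_action S) \<rho>) A act f"
    and rA: "right_act S A act"
    using A by (auto simp: fp_act_def)
  let ?Q = "free_act S X // \<rho>" and ?q = "quot_action (free_action S) \<rho>"
  have mon: "monoid S" using S by (simp add: right_coherent_def)
  have rQ: "right_act S ?Q ?q"
    using right_act_quot[OF right_act_free[OF mon]] fg by (auto simp: fg_congruence_def)
  define h where "h = inv_into ?Q f"
  have h: "act_iso S A act ?Q ?q h" unfolding h_def by (rule act_iso_inv[OF rQ iso])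
  have hB: "act_iso S B act (h ` B) ?q h" by (rule act_iso_subact[OF h B(1)])
  have rB: "right_act S B act" by (rule subact_right_act[OF rA B(1)])
  have ac: "\<And>b s. b \<in> B \<Longrightarrow> s \<in> carrier S \<Longrightarrow> ?q (h b) s = h (act b s)"
    using hB by (simp add: act_iso_def)
  have "fp_act S ?Q ?q" by (rule fp_act_iso[OF A h rQ])
  moreover have "subact S (h ` B) ?Q ?q"
  proof -
    have "h ` B \<subseteq> ?Q" using h B(1) unfolding subact_def act_iso_def bij_betw_def by blast
    then show ?thesis using B(1) ac by (auto simp: subact_def)
  qed
  moreover have "fg_act S (h ` B) ?q"
  proof -
    obtain G where G: "finite G" "G \<subseteq> B" "B = (\<Union>g\<in>G. act g ` carrier S)"
      using B(2) by (auto simp: fg_act_def)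
    have "(\<Union>g\<in>h ` G. ?q g ` carrier S) = (\<Union>g\<in>G. h ` act g ` carrier S)"
      using G(2) ac by (fastforce simp: image_iff)
    also have "\<dots> = h ` (\<Union>g\<in>G. act g ` carrier S)" by blast
    also have "\<dots> = h ` B" using G(3) by simp
    finally show ?thesis
      unfolding fg_act_def using G(1,2) by (intro exI[of _ "h ` G"]) auto
  qed
  ultimately have "fp_act S (h ` B) ?q" using S unfolding right_coherent_def by blast
  then show ?thesis using act_iso_inv[OF rB hB] rB by (rule fp_act_iso)
qed

end

theory Submission
  imports Defs
begin

text \<open>The identity \<open>e\<close> of the ideal \<open>I\<close> is a central idempotent of \<open>S\<close>, so \<open>s \<mapsto> e s\<close> is a
  retraction of \<open>S\<close> onto \<open>I\<close>. Through it the \<open>I\<close>-acts become exactly the \<open>S\<close>-acts on which \<open>e\<close> acts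
  trivially, with the same subacts, generating sets and congruences. Finite presentability agrees as
  well: an \<open>I\<close>-presentation becomes an \<open>S\<close>-presentation after adding the relations \<open>x 1 = x e\<close>, and
  an \<open>S\<close>-presentation becomes an \<open>I\<close>-presentation after multiplying its relations by \<open>e\<close>.\<close>

section \<open>Finite presentations as kernels of surjections from free acts\<close>

definition kernel_on :: "('b \<Rightarrow> 'c) \<Rightarrow> 'b set \<Rightarrow> ('b \<times> 'b) set" where
  "kernel_on p F = {(u, v). u \<in> F \<and> v \<in> F \<and> p u = p v}"

definition act_hom ::
    "('a, 'm) monoid_scheme \<Rightarrow> 'b set \<Rightarrow> ('b \<Rightarrow> 'a \<Rightarrow> 'b) \<Rightarrow> ('c \<Rightarrow> 'a \<Rightarrow> 'c) \<Rightarrow> ('b \<Rightarrow> 'c) \<Rightarrow> bool"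
  where "act_hom S F m act p \<longleftrightarrow> (\<forall>u\<in>F. \<forall>s\<in>carrier S. p (m u s) = act (p u) s)"

lemma act_congruence_kernel:
  assumes "right_act S F m" "act_hom S F m act p"
  shows "act_congruence S F m (kernel_on p F)"
proof -
  interpret right_act S F m by fact
  have "equiv F (kernel_on p F)"
    by (intro equivI) (auto simp: kernel_on_def refl_on_def sym_def trans_def)
  then show ?thesis
    using assms(2) by (auto simp: act_congruence_def kernel_on_def act_hom_def act_closed)
qed

text \<open>First isomorphism theorem for acts. A kernel class is mapped by \<open>p\<close> onto a
  singleton, so \<open>the_elem\<close> reads off the common value without choosing a
  representative.\<close>

lemma act_iso_quot_kernel:
  assumes F: "right_act S F m" and p: "act_hom S F m act p" "p ` F = A"
  shows "act_iso S (F // kernel_on p F) (quot_action m (kernel_on p F)) A act (\<lambda>C. the_elem (p ` C))"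
proof -
  interpret right_act S F m by fact
  let ?K = "kernel_on p F"
  note cK = act_congruence_kernel[OF F p(1)]
  have val: "the_elem (p ` (?K `` {u})) = p u" if "u \<in> F" for u
  proof -
    have "p ` (?K `` {u}) = {p u}" using that by (auto simp: kernel_on_def)
    then show ?thesis by simp
  qed
  have cls: "?K `` {u} = ?K `` {v}" if "u \<in> F" "v \<in> F" "p u = p v" for u v
    using that by (auto simp: kernel_on_def)
  have "bij_betw (\<lambda>C. the_elem (p ` C)) (F // ?K) A"
  proof (rule bij_betw_imageI)
    show "inj_on (\<lambda>C. the_elem (p ` C)) (F // ?K)"
    proof (rule inj_onI)
      fix C D
      assume "C \<in> F // ?K" "D \<in> F // ?K" and eq: "the_elem (p ` C) = the_elem (p ` D)"
      then obtain u v where uv: "u \<in> F" "C = ?K `` {u}" "v \<in> F" "D = ?K `` {v}"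
        by (elim quotientE)
      with eq have "p u = p v" by (simp add: val)
      then show "C = D" unfolding uv(2,4) by (rule cls[OF uv(1,3)])
    qed
    show "(\<lambda>C. the_elem (p ` C)) ` (F // ?K) = A"
      unfolding p(2)[symmetric] quotient_def by (auto simp: val image_UN)
  qed
  moreover have "the_elem (p ` quot_action m ?K C s) = act (the_elem (p ` C)) s"
    if C: "C \<in> F // ?K" and s: "s \<in> carrier S" for C s
  proof -
    obtain u where u: "u \<in> F" "C = ?K `` {u}" using C by (auto elim: quotientE)
    then show ?thesis
      using quot_action_class[OF F cK u(1) s] val[OF u(1)] val[OF act_closed[OF u(1) s]] p(1) s
      by (simp add: act_hom_def)
  qed
  ultimately show ?thesis by (simp add: act_iso_def)
qed

text \<open>Trades the pair of a congruence and an isomorphism from its quotient for one surjection,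
  so that presentations can be moved between monoids by computing with elements of free acts instead
  of classes.\<close>

lemma fp_act_iff_kernel:
  "fp_act S A act \<longleftrightarrow> right_act S A act \<and>
     (\<exists>(X :: nat set) p. finite X \<and> act_hom S (free_act S X) (free_action S) act p \<and>
        p ` free_act S X = A \<and>
        fg_congruence S (free_act S X) (free_action S) (kernel_on p (free_act S X)))"
    (is "?L \<longleftrightarrow> ?R")
proof
  assume ?L
  then obtain X :: "nat set" and \<rho> f where A: "right_act S A act" and X: "finite X"
    and fg: "fg_congruence S (free_act S X) (free_action S) \<rho>"
    and iso: "act_iso S (free_act S X // \<rho>) (quot_action (free_action S) \<rho>) A act f"
    by (auto simp: fp_act_def)
  interpret right_act S A act by fact
  let ?F = "free_act S X" and ?m = "free_action S"
  have F: "right_act S ?F ?m" by (rule right_act_free) unfold_locales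
  have cg: "act_congruence S ?F ?m \<rho>" and eq: "equiv ?F \<rho>"
    using fg by (auto simp: fg_congruence_def act_congruence_def)
  have b: "inj_on f (?F // \<rho>)" "f ` (?F // \<rho>) = A"
    and h: "\<And>C s. C \<in> ?F // \<rho> \<Longrightarrow> s \<in> carrier S \<Longrightarrow> f (quot_action ?m \<rho> C s) = act (f C) s"
    using iso by (auto simp: act_iso_def bij_betw_def)
  \<comment> \<open>The class map followed by the given isomorphism; injectivity of \<open>f\<close>
    on classes makes its kernel exactly \<open>\<rho>\<close>.\<close>
  define p where "p u = f (\<rho> `` {u})" for u
  have "act_hom S ?F ?m act p"
    unfolding act_hom_def p_def by (metis quot_action_class[OF F cg] h quotientI)
  moreover have "p ` ?F = A"
    unfolding b(2)[symmetric] quotient_def by (auto simp: p_def)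
  moreover have "kernel_on p ?F = \<rho>"
  proof -
    have "p u = p v \<longleftrightarrow> (u, v) \<in> \<rho>" if "u \<in> ?F" "v \<in> ?F" for u v
      using that b(1) eq_equiv_class_iff[OF eq that] by (auto simp: p_def inj_on_eq_iff quotientI)
    moreover have "\<rho> \<subseteq> ?F \<times> ?F" using eq by (auto simp: equiv_def)
    ultimately show ?thesis by (auto simp: kernel_on_def)
  qed
  ultimately show ?R using A X fg by metis
next
  assume R: ?R
  then interpret right_act S A act by blast
  have "right_act S (free_act S X) (free_action S)" for X :: "nat set"
    by (rule right_act_free) unfold_locales
  with R show ?L unfolding fp_act_def by (blast intro: act_iso_quot_kernel)
qed

section \<open>The ideal as a retract of the monoid\<close>

locale ideal_with_identity = monoid S for S (structure) +
  fixes I :: "'a set" and e :: 'a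
  assumes ideal: "monoid_ideal I S"
    and e_in: "e \<in> I"
    and e_id: "a \<in> I \<Longrightarrow> e \<otimes> a = a" "a \<in> I \<Longrightarrow> a \<otimes> e = a"
begin

abbreviation T where "T \<equiv> S\<lparr>carrier := I, one := e\<rparr>"

lemma in_carrier: "a \<in> I \<Longrightarrow> a \<in> carrier S"
  using ideal by (auto simp: monoid_ideal_def)

lemma ideal_mult: "s \<in> carrier S \<Longrightarrow> a \<in> I \<Longrightarrow> s \<otimes> a \<in> I" "s \<in> carrier S \<Longrightarrow> a \<in> I \<Longrightarrow> a \<otimes> s \<in> I"
  using ideal by (auto simp: monoid_ideal_def)

lemma e_carrier: "e \<in> carrier S"
  using e_in by (rule in_carrier)

text \<open>Both products lie in \<open>I\<close>, where \<open>e\<close> is neutral on either side,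
  so both equal \<open>e \<otimes> s \<otimes> e\<close>.\<close>

lemma e_central: "s \<in> carrier S \<Longrightarrow> s \<otimes> e = e \<otimes> s"
  by (metis e_id e_in e_carrier ideal_mult m_assoc)

text \<open>The inner \<open>e\<close> is absorbed on the right by \<open>e \<otimes> s\<close>,
  which lies in \<open>I\<close>.\<close>

lemma retraction_mult:
  assumes "s \<in> carrier S" "t \<in> carrier S"
  shows "e \<otimes> (s \<otimes> t) = (e \<otimes> s) \<otimes> (e \<otimes> t)"
proof -
  have "(e \<otimes> s) \<otimes> (e \<otimes> t) = ((e \<otimes> s) \<otimes> e) \<otimes> t"
    using assms e_carrier by (simp add: m_assoc)
  then show ?thesis
    using assms e_carrier e_in ideal_mult by (simp add: e_id m_assoc)
qed

lemma monoid_T: "monoid T"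
  by (rule monoidI) (auto simp: ideal_mult in_carrier e_in e_id m_assoc)

text \<open>Restriction of scalars along the retraction of \<open>S\<close> onto \<open>T\<close>.
  The underlying set stays the same, and elements of \<open>I\<close> act as before.\<close>

definition ext :: "('c \<Rightarrow> 'a \<Rightarrow> 'c) \<Rightarrow> 'c \<Rightarrow> 'a \<Rightarrow> 'c" where
  "ext act a s = act a (e \<otimes> s)"

lemma right_act_ext:
  assumes "right_act T A act"
  shows "right_act S A (ext act)"
proof -
  interpret A: right_act T A act by fact
  show ?thesis
    using A.act_closed A.act_one A.act_mult
    by unfold_locales (auto simp: ext_def retraction_mult ideal_mult e_in e_carrier)
qed

lemma subact_ext: "subact T B A act \<Longrightarrow> subact S B A (ext act)"
  by (auto simp: subact_def ext_def ideal_mult e_in)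

lemma retraction_image: "(\<otimes>) e ` carrier S = I"
  using e_in ideal_mult in_carrier by (force simp: e_id image_iff)

text \<open>The retraction is onto \<open>I\<close>, so each generator has the same orbit under
  \<open>S\<close> as under \<open>T\<close>.\<close>

lemma fg_act_ext:
  assumes "fg_act T B act"
  shows "fg_act S B (ext act)"
proof -
  have "ext act g ` carrier S = act g ` I" for g
    unfolding retraction_image[symmetric] by (auto simp: ext_def)
  then show ?thesis using assms by (simp add: fg_act_def)
qed

section \<open>Transfer of presentations between the ideal and the monoid\<close>

lemma fp_act_ext:
  assumes "fp_act T A act"
  shows "fp_act S A (ext act)"
proof -
  obtain X :: "nat set" and p where A: "right_act T A act" and X: "finite X"
    and hom: "act_hom T (free_act T X) (free_action T) act p"
    and img: "p ` free_act T X = A"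
    and fg: "fg_congruence T (free_act T X) (free_action T) (kernel_on p (free_act T X))"
    using assms unfolding fp_act_iff_kernel by blast
  let ?FS = "free_act S X" and ?FT = "free_act T X"
  obtain H where H: "finite H" "H \<subseteq> kernel_on p ?FT"
    "\<And>\<sigma>. act_congruence T ?FT (free_action T) \<sigma> \<Longrightarrow> H \<subseteq> \<sigma> \<Longrightarrow> kernel_on p ?FT \<subseteq> \<sigma>"
    using fg unfolding fg_congruence_def by metis
  \<comment> \<open>The presentation \<open>p\<close> composed with the retraction of
    \<open>?FS\<close> onto \<open>?FT\<close>, on the same generators.\<close>
  define q where "q u = p (fst u, e \<otimes> snd u)" for u
  have FS: "right_act S ?FS (free_action S)" by (rule right_act_free) unfold_locales
  have hom': "act_hom S ?FS (free_action S) (ext act) q"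
    using hom by (auto simp: act_hom_def q_def ext_def free_act_def free_action_def
        retraction_mult ideal_mult e_in)
  have img': "q ` ?FS = A"
  proof -
    have "q ` ?FS = p ` (X \<times> ((\<otimes>) e ` carrier S))"
      by (force simp: q_def free_act_def)
    then show ?thesis using img by (simp add: retraction_image free_act_def)
  qed
  \<comment> \<open>One relation per generator, identifying \<open>\<one>\<close> with
    \<open>e\<close>. These reduce any pair in the kernel of \<open>q\<close> to a pair in the
    kernel of \<open>p\<close>, which \<open>H\<close> then handles.\<close>
  define E where "E = (\<lambda>x. ((x, \<one>), (x, e))) ` X"
  have "fg_congruence S ?FS (free_action S) (kernel_on q ?FS)"
    unfolding fg_congruence_def
  proof (intro conjI exI allI impI)
    show "act_congruence S ?FS (free_action S) (kernel_on q ?FS)"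
      by (rule act_congruence_kernel[OF FS hom'])
    show "finite (H \<union> E)" using H(1) X by (simp add: E_def)
    show "H \<union> E \<subseteq> kernel_on q ?FS"
      using H(2) by (auto simp: E_def kernel_on_def q_def free_act_def e_in e_id e_carrier
          dest: in_carrier subsetD)
    fix \<sigma> assume "act_congruence S ?FS (free_action S) \<sigma> \<and> H \<union> E \<subseteq> \<sigma>"
    then have eq: "equiv ?FS \<sigma>" and HE: "H \<subseteq> \<sigma>" "E \<subseteq> \<sigma>"
      and c: "\<And>u v s. (u, v) \<in> \<sigma> \<Longrightarrow> s \<in> carrier S \<Longrightarrow> (free_action S u s, free_action S v s) \<in> \<sigma>"
      by (auto simp: act_congruence_def)
    have r: "\<And>u. u \<in> ?FS \<Longrightarrow> (u, u) \<in> \<sigma>" and s: "sym \<sigma>" and t: "trans \<sigma>"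
      using eq by (auto simp: equiv_def refl_on_def)
    have sub: "?FT \<subseteq> ?FS" by (auto simp: free_act_def in_carrier)
    \<comment> \<open>An \<open>S\<close>-congruence cut down to \<open>?FT\<close> is a
      \<open>T\<close>-congruence, so the minimality of \<open>kernel_on p ?FT\<close> over
      \<open>H\<close> applies to it.\<close>
    let ?\<tau> = "\<sigma> \<inter> ?FT \<times> ?FT"
    have "equiv ?FT ?\<tau>"
    proof (intro equivI)
      show "refl_on ?FT ?\<tau>" using r sub by (auto simp: refl_on_def)
      show "sym ?\<tau>" using s by (auto simp: sym_def)
      show "trans ?\<tau>" using t by (auto intro!: transI dest: transD)
    qed auto
    moreover have "(free_action T u a, free_action T v a) \<in> ?\<tau>"
      if "(u, v) \<in> ?\<tau>" "a \<in> I" for u v a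
      using c[of u v a] that by (auto simp: free_act_def free_action_def ideal_mult in_carrier)
    ultimately have "act_congruence T ?FT (free_action T) ?\<tau>"
      by (auto simp: act_congruence_def)
    moreover have "H \<subseteq> ?\<tau>" using HE(1) H(2) by (auto simp: kernel_on_def)
    ultimately have K: "kernel_on p ?FT \<subseteq> \<sigma>" using H(3) by blast
    \<comment> \<open>The relation of \<open>E\<close> at \<open>x\<close>, acted on by
      \<open>a\<close>.\<close>
    have e: "((x, a), (x, e \<otimes> a)) \<in> \<sigma>" if "x \<in> X" "a \<in> carrier S" for x a
      using c[of "(x, \<one>)" "(x, e)" a] HE(2) that by (auto simp: E_def free_action_def)
    show "kernel_on q ?FS \<subseteq> \<sigma>"
    proof (clarsimp simp: kernel_on_def free_act_def q_def)
      fix x a y b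
      assume *: "x \<in> X" "a \<in> carrier S" "y \<in> X" "b \<in> carrier S" "p (x, e \<otimes> a) = p (y, e \<otimes> b)"
      then have "((x, e \<otimes> a), (y, e \<otimes> b)) \<in> \<sigma>"
        using K by (auto simp: kernel_on_def free_act_def ideal_mult e_in)
      then show "((x, a), (y, b)) \<in> \<sigma>"
        using e[OF *(1,2)] e[OF *(3,4)] s t by (meson symD transD)
    qed
  qed
  with X hom' img' right_act_ext[OF A] show ?thesis
    unfolding fp_act_iff_kernel by blast
qed

text \<open>The same generators serve, with \<open>q\<close> restricted to \<open>?FT\<close> and
  each relation in \<open>H\<close> moved into \<open>?FT\<close> by the retraction
  \<open>r\<close>. Minimality follows by pulling \<open>T\<close>-congruences back along
  \<open>r\<close>.\<close>

lemma fp_act_restrict: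
  assumes B: "right_act T B act" and fp: "fp_act S B (ext act)"
  shows "fp_act T B act"
proof -
  obtain X :: "nat set" and q where X: "finite X"
    and hom: "act_hom S (free_act S X) (free_action S) (ext act) q"
    and img: "q ` free_act S X = B"
    and fg: "fg_congruence S (free_act S X) (free_action S) (kernel_on q (free_act S X))"
    using fp unfolding fp_act_iff_kernel by blast
  let ?FS = "free_act S X" and ?FT = "free_act T X"
  obtain H where H: "finite H" "H \<subseteq> kernel_on q ?FS"
    "\<And>\<sigma>. act_congruence S ?FS (free_action S) \<sigma> \<Longrightarrow> H \<subseteq> \<sigma> \<Longrightarrow> kernel_on q ?FS \<subseteq> \<sigma>"
    using fg unfolding fg_congruence_def by metis
  interpret B: right_act T B act by fact
  have FT: "right_act T ?FT (free_action T)" by (rule right_act_free[OF monoid_T])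
  define r where "r u = (fst u, e \<otimes> snd u)" for u :: "nat \<times> 'a"
  have rF: "r u \<in> ?FT" if "u \<in> ?FS" for u
    using that by (auto simp: r_def free_act_def ideal_mult e_in)
  have rT: "r u = u" if "u \<in> ?FT" for u
    using that by (auto simp: r_def free_act_def e_id)
  have r_act: "r (free_action S u s) = free_action T (r u) (e \<otimes> s)"
    if "u \<in> ?FS" "s \<in> carrier S" for u s
    using that by (auto simp: r_def free_act_def free_action_def retraction_mult)
  \<comment> \<open>By centrality \<open>r u\<close> is \<open>u\<close> acted on by
    \<open>e\<close>, and \<open>e\<close> acts as the identity on \<open>B\<close>.\<close>
  have qr: "q (r u) = q u" if u: "u \<in> ?FS" for u
  proof -
    have "r u = free_action S u e"
      using u by (auto simp: r_def free_act_def free_action_def e_central)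
    then have "q (r u) = ext act (q u) e"
      using hom u e_carrier by (simp add: act_hom_def)
    then show ?thesis
      using B.act_one img u by (auto simp: ext_def e_id e_in)
  qed
  have sub: "?FT \<subseteq> ?FS" by (auto simp: free_act_def in_carrier)
  have hom': "act_hom T ?FT (free_action T) act q"
    unfolding act_hom_def
  proof (intro ballI)
    fix u s assume us: "u \<in> ?FT" "s \<in> carrier T"
    then have "q (free_action S u s) = ext act (q u) s"
      using hom sub in_carrier by (auto simp: act_hom_def)
    then show "q (free_action T u s) = act (q u) s"
      using us by (simp add: ext_def e_id free_action_def)
  qed
  have img': "q ` ?FT = B"
  proof
    show "q ` ?FT \<subseteq> B" using img sub by blast
    show "B \<subseteq> q ` ?FT"
    proof
      fix b assume "b \<in> B"
      then obtain u where "u \<in> ?FS" "b = q u" using img by blast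
      then show "b \<in> q ` ?FT" using rF qr by (intro image_eqI[of _ _ "r u"]) auto
    qed
  qed
  have "fg_congruence T ?FT (free_action T) (kernel_on q ?FT)"
    unfolding fg_congruence_def
  proof (intro conjI exI allI impI)
    show "act_congruence T ?FT (free_action T) (kernel_on q ?FT)"
      by (rule act_congruence_kernel[OF FT hom'])
    show "finite (map_prod r r ` H)" using H(1) by simp
    show "map_prod r r ` H \<subseteq> kernel_on q ?FT"
      using H(2) rF qr by (auto simp: kernel_on_def dest!: subsetD)
    fix \<tau> assume \<tau>: "act_congruence T ?FT (free_action T) \<tau> \<and> map_prod r r ` H \<subseteq> \<tau>"
    then have rf: "refl_on ?FT \<tau>" and sy: "sym \<tau>" and tr: "trans \<tau>"
      and c: "\<And>u v s. (u, v) \<in> \<tau> \<Longrightarrow> s \<in> I \<Longrightarrow> (free_action T u s, free_action T v s) \<in> \<tau>"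
      by (auto simp: act_congruence_def equiv_def)
    \<comment> \<open>The inverse image of \<open>\<tau>\<close> under \<open>r\<close>. It contains
      \<open>H\<close> because \<open>\<tau>\<close> contains the image of \<open>H\<close>, and it
      agrees with \<open>\<tau>\<close> on \<open>?FT\<close>, where \<open>r\<close> is the
      identity.\<close>
    define \<sigma> where "\<sigma> = {(u, v). u \<in> ?FS \<and> v \<in> ?FS \<and> (r u, r v) \<in> \<tau>}"
    have "equiv ?FS \<sigma>"
    proof (intro equivI)
      show "\<sigma> \<subseteq> ?FS \<times> ?FS" by (auto simp: \<sigma>_def)
      show "refl_on ?FS \<sigma>" using rf rF unfolding \<sigma>_def refl_on_def by blast
      show "sym \<sigma>" using sy unfolding \<sigma>_def by (blast intro: symI dest: symD)
      show "trans \<sigma>" using tr unfolding \<sigma>_def by (blast intro: transI dest: transD)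
    qed
    moreover have "(free_action S u s, free_action S v s) \<in> \<sigma>"
      if uv: "(u, v) \<in> \<sigma>" and s: "s \<in> carrier S" for u v s
    proof -
      have "(r (free_action S u s), r (free_action S v s)) \<in> \<tau>"
        using uv s c[of "r u" "r v" "e \<otimes> s"] by (simp add: \<sigma>_def r_act ideal_mult e_in)
      then show ?thesis
        using uv s by (auto simp: \<sigma>_def free_act_def free_action_def)
    qed
    ultimately have "act_congruence S ?FS (free_action S) \<sigma>"
      by (auto simp: act_congruence_def)
    moreover have "H \<subseteq> \<sigma>"
      using H(2) \<tau> by (fastforce simp: \<sigma>_def kernel_on_def)
    ultimately have K: "kernel_on q ?FS \<subseteq> \<sigma>" by (rule H(3))
    show "kernel_on q ?FT \<subseteq> \<tau>"
    proof (rule subrelI)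
      fix u v assume uv: "(u, v) \<in> kernel_on q ?FT"
      then have "(u, v) \<in> \<sigma>" using K sub by (auto simp: kernel_on_def)
      then show "(u, v) \<in> \<tau>" using uv rT by (simp add: \<sigma>_def kernel_on_def)
    qed
  qed
  with X hom' img' B show ?thesis
    unfolding fp_act_iff_kernel by blast
qed

end

theorem corollary4p2:
  fixes S :: "('a, 'm) monoid_scheme" and I :: "'a set" and e :: 'a
  assumes "right_coherent S"
    and "monoid_ideal I S"
    and "e \<in> I" and "\<And>a. a \<in> I \<Longrightarrow> e \<otimes>\<^bsub>S\<^esub> a = a \<and> a \<otimes>\<^bsub>S\<^esub> e = a"
  shows "right_coherent (S\<lparr>carrier := I, one := e\<rparr>)"
proof -
  interpret monoid S using assms(1) by (simp add: right_coherent_def)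
  interpret ideal_with_identity S I e
    by unfold_locales (use assms in auto)
  show ?thesis
    unfolding right_coherent_def
  proof (intro conjI allI impI)
    show "monoid T" by (rule monoid_T)
    \<comment> \<open>\<open>S\<close> and \<open>T\<close> share the element type
      \<open>'a\<close>, so both coherence conditions range over acts of the same type, and that of
      \<open>S\<close> applies directly to \<open>A\<close> and \<open>B\<close> under
      \<open>ext act\<close>.\<close>
    fix A :: "(nat \<times> 'a) set set" and act B
    assume *: "fp_act T A act \<and> subact T B A act \<and> fg_act T B act"
    then have "fp_act S B (ext act)"
      using assms(1) fp_act_ext subact_ext fg_act_ext unfolding right_coherent_def by blast
    moreover have "right_act T B act"
      using * subact_right_act by (auto simp: fp_act_def)
    ultimately show "fp_act T B act" by (rule fp_act_restrict[rotated])
  qed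
qed

end
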